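(* Let $S$ be a finite set of integers, let $\omega \in S^{\mathbb{N}}$ be a word with bounded additive complexity, and suppose $p/q = \mathrm{slope}(\omega) \in \mathbb{Q}$. If $\mathcal{I}$ is a set of separated intervals such that $\mathrm{slope}(\omega[m,n]) = p/q$ for all $[m,n] \in \mathcal{I}$, then the contracted word $\omega \setminus \mathcal{I}$ has bounded additive complexity and $\mathrm{slope}(\omega \setminus \mathcal{I}) = p/q$.
   Context: $\mathbb{N}$ denotes the positive integers. Alphabets are finite sets of integers. An infinite word over $S$ is a sequence $\omega = x_1x_2x_3\cdots$ with $x_i \in S$; $S^{\mathbb{N}}$ is the set of these. For $m \le n$ in $\mathbb{N}$, $\omega[m,n] = x_m x_{m+1}\cdots x_n$; the nonempty factors of $\omega$ are the finite words of this form. $|B|$ is the length of a finite word $B$, and if $B = y_1\cdots y_n$ then $\sum B = y_1+\cdots+y_n$. $\omega$ has bounded additive complexity if there is $M\in\mathbb{N}$ such that for every $n\in\mathbb{N}$ the set $\{\sum B : B \text{ a factor of } \omega,\ |B|=n\}$ has at most $M$ elements. For a nonempty finite word $B$, $\mathrm{slope}(B) = \frac{1}{|B|}\sum B$; for an infinite word, $\mathrm{slope}(\omega) = \lim_{n\to\infty} \mathrm{slope}(\omega[1,n])$, if this limit exists (it exists whenever $\omega$ has bounded additive complexity). An interval is a set $[m,n] = \{m, m+1, \dots, n\}$ with $m \le n$ in $\mathbb{N}$. A (finite or infinite) set $\mathcal{I}$ of intervals is separated if for any two distinct $[i,j],[k,\ell] \in \mathcal{I}$ with $i \le k$ we have $j+1<k$.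 The contraction $\omega\setminus[i,j]$ is the word $\omega'$ with $\omega'(k)=\omega(k)$ for $k<i$ and $\omega'(k) = \omega(k+j-i+1)$ for $k\ge i$, i.e. the letters in positions $i,\dots,j$ are deleted. For a set $\mathcal{I}$ of separated intervals, $\omega\setminus\mathcal{I}$ is the infinite word obtained from $\omega$ by deleting all letters whose positions lie in some interval of $\mathcal{I}$ (keeping the remaining letters in order). *)

theory Defs
  imports Complex_Main "HOL-Library.Infinite_Set" "HOL-Library.FuncSet"
begin

text \<open>Infinite words are functions on \<^typ>\<open>nat\<close> of which only the values at positions
  \<open>1, 2, 3, \<dots>\<close> matter; the value at \<open>0\<close> is never used.\<close>

type_synonym infword = "nat \<Rightarrow> int"

definition infwords :: "int set \<Rightarrow> infword set" where
  "infwords S = {1..} \<rightarrow> S"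

definition subword :: "infword \<Rightarrow> nat \<Rightarrow> nat \<Rightarrow> int list" where
  "subword \<omega> m n = map \<omega> [m..<Suc n]"

definition factors :: "infword \<Rightarrow> int list set" where
  "factors \<omega> = {subword \<omega> m n | m n. 1 \<le> m \<and> m \<le> n}"

text \<open>Finiteness is required explicitly because the cardinality of an infinite set is \<open>0\<close>.\<close>

definition bounded_additive_complexity :: "infword \<Rightarrow> bool" where
  "bounded_additive_complexity \<omega> \<longleftrightarrow>
     (\<exists>M\<ge>1. \<forall>n\<ge>1. finite {sum_list B | B. B \<in> factors \<omega> \<and> length B = n} \<and>
                  card {sum_list B | B. B \<in> factors \<omega> \<and> length B = n} \<le> M)"

definition slope :: "int list \<Rightarrow> real" where
  "slope B = real_of_int (sum_list B) / real (length B)"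

text \<open>The slope of an infinite word is a limit: \<open>has_slope \<omega> s\<close> says that it exists and
  equals \<open>s\<close>.\<close>

definition has_slope :: "infword \<Rightarrow> real \<Rightarrow> bool" where
  "has_slope \<omega> s \<longleftrightarrow> (\<lambda>n. slope (subword \<omega> 1 n)) \<longlonglongrightarrow> s"

definition separated_intervals :: "nat set set \<Rightarrow> bool" where
  "separated_intervals \<I> \<longleftrightarrow>
     (\<forall>I\<in>\<I>. \<exists>m n. 1 \<le> m \<and> m \<le> n \<and> I = {m..n}) \<and>
     (\<forall>i j k l. i \<le> j \<and> k \<le> l \<and> {i..j} \<in> \<I> \<and> {k..l} \<in> \<I> \<and>
                {i..j} \<noteq> {k..l} \<and> i \<le> k \<longrightarrow> j + 1 < k)"

definition remaining_positions :: "nat set set \<Rightarrow> nat set" where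
  "remaining_positions \<I> = {1..} - \<Union>\<I>"

text \<open>\<^const>\<open>enumerate\<close> counts from \<open>0\<close>, so the letter at position \<open>k \<ge> 1\<close> of the contracted word
  is the letter of \<open>\<omega>\<close> at the \<open>k\<close>-th remaining position. This is meaningful because infinitely
  many positions remain, see \<open>infinite_remaining_positions\<close> below.\<close>

definition contraction :: "infword \<Rightarrow> nat set set \<Rightarrow> infword" where
  "contraction \<omega> \<I> k = \<omega> (enumerate (remaining_positions \<I>) (k - 1))"

lemma infinite_remaining_positions:
  assumes sep: "separated_intervals \<I>"
  shows "infinite (remaining_positions \<I>)"
  unfolding infinite_nat_iff_unbounded
proof
  fix N :: nat
  show "\<exists>n>N. n \<in> remaining_positions \<I>"
  proof (cases "Suc N \<in> \<Union>\<I>")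
    case False
    then show ?thesis by (auto simp: remaining_positions_def intro!: exI[of _ "Suc N"])
  next
    case True
    then obtain i j where ij: "{i..j} \<in> \<I>" "i \<le> Suc N" "Suc N \<le> j"
      using sep unfolding separated_intervals_def by (metis Union_iff atLeastAtMost_iff)
    have "Suc j \<notin> \<Union>\<I>"
    proof
      assume "Suc j \<in> \<Union>\<I>"
      then obtain k l where kl: "{k..l} \<in> \<I>" "k \<le> Suc j" "Suc j \<le> l"
        using sep unfolding separated_intervals_def by (metis Union_iff atLeastAtMost_iff)
      have ne: "{i..j} \<noteq> {k..l}" using kl by (metis atLeastAtMost_iff not_less_eq_eq order_refl)
      have le: "i \<le> j" "k \<le> l" using ij kl by auto
      have "i \<le> k \<Longrightarrow> j + 1 < k" "k \<le> i \<Longrightarrow> l + 1 < i"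
        using sep ij(1) kl(1) ne le unfolding separated_intervals_def by metis+
      then show False using ij kl by linarith
    qed
    then show ?thesis using ij by (auto simp: remaining_positions_def intro!: exI[of _ "Suc j"])
  qed
qed

end

theory Submission imports Defs begin

text \<open>Over a finite alphabet, bounded additive complexity with slope \<open>\<alpha>\<close> is the same as bounded discrepancy: the sum of
  every factor of length \<open>n\<close> differs from \<open>n\<alpha>\<close> by at most a constant. Indeed, shifting a window by
  one position changes its sum by a bounded amount, so few sums of length \<open>n\<close> means that all
  of them are close to each other, and averaging consecutive blocks compares them with \<open>n\<alpha>\<close>.
  A factor of the contracted word arises from a factor of the original word with the same
  discrepancy, because each deleted interval has discrepancy \<open>0\<close>.\<close>

definition bounded_discrepancy :: "infword \<Rightarrow> real \<Rightarrow> bool" where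
  "bounded_discrepancy w \<alpha> \<longleftrightarrow>
     (\<exists>C. \<forall>m\<ge>1. \<forall>n. \<bar>real_of_int (\<Sum>k<n. w (m + k)) - real n * \<alpha>\<bar> \<le> C)"

section \<open>Factor sums as sums over windows\<close>

lemma sum_list_subword: "sum_list (subword w m n) = (\<Sum>k\<in>{m..n}. w k)"
  by (simp add: subword_def interv_sum_list_conv_sum_set_nat flip: atLeastLessThanSuc_atLeastAtMost
      del: upt_Suc)

lemma length_subword: "length (subword w m n) = Suc n - m"
  by (simp add: subword_def del: upt_Suc)

lemma sum_window: "(\<Sum>k\<in>{m..<m + n}. f k) = (\<Sum>k<n. f (m + k))"
  for f :: "nat \<Rightarrow> 'a::comm_monoid_add"
  using sum.shift_bounds_nat_ivl[of f 0 m n] by (simp add: add.commute lessThan_atLeast0)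

text \<open>Indexing the factor sums by the starting position lets them be treated as a sequence.
  The case \<open>n = 0\<close> is excluded because factors are nonempty: the left side would be
  empty and the right side \<open>{0}\<close>.\<close>

lemma sum_list_factors_eq:
  assumes "n \<ge> 1"
  shows "{sum_list B | B. B \<in> factors w \<and> length B = n} = (\<lambda>m. \<Sum>k<n. w (m + k)) ` {1..}"
proof (intro equalityI subsetI)
  fix x assume "x \<in> {sum_list B | B. B \<in> factors w \<and> length B = n}"
  then obtain m l where ml: "1 \<le> m" "m \<le> l" "x = sum_list (subword w m l)" "Suc l - m = n"
    by (auto simp: factors_def length_subword)
  then have "{m..l} = {m..<m + n}" by auto
  then show "x \<in> (\<lambda>m. \<Sum>k<n. w (m + k)) ` {1..}"
    using ml by (auto simp: sum_list_subword sum_window)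
next
  fix x assume "x \<in> (\<lambda>m. \<Sum>k<n. w (m + k)) ` {1..}"
  then obtain m where m: "1 \<le> m" "x = (\<Sum>k<n. w (m + k))" by auto
  have "{m..m + n - 1} = {m..<m + n}" using assms by auto
  then have "x = sum_list (subword w m (m + n - 1))"
    using m by (simp add: sum_list_subword sum_window)
  moreover have "subword w m (m + n - 1) \<in> factors w"
    using m assms unfolding factors_def by force
  ultimately show "x \<in> {sum_list B | B. B \<in> factors w \<and> length B = n}"
    using assms by (auto simp: length_subword)
qed

section \<open>From few factor sums to nearly equal factor sums\<close>

text \<open>One climbs from \<open>v\<close> to \<open>u\<close> or beyond through elements of
  \<open>V\<close> in upward steps of size at most \<open>D\<close>. Each step strictly lowers the
  number of elements of \<open>V\<close> above the current one, so this number serves as induction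
  measure and bounds the number of steps.\<close>

lemma Max_diff_le_card:
  fixes V :: "int set"
  assumes "finite V" and D: "D \<ge> 0"
    and step: "\<And>v u. v \<in> V \<Longrightarrow> u \<in> V \<Longrightarrow> v < u \<Longrightarrow> \<exists>v'\<in>V. v < v' \<and> v' \<le> v + D"
    and "v \<in> V" "u \<in> V"
  shows "u - v \<le> D * int (card V)"
proof -
  have "u - v \<le> D * int (card {y \<in> V. y > v})" using \<open>v \<in> V\<close>
  proof (induction "card {y \<in> V. y > v}" arbitrary: v rule: less_induct)
    case less
    show ?case
    proof (cases "v < u")
      case False
      then show ?thesis using D by (smt (verit) mult_nonneg_nonneg of_nat_0_le_iff)
    next
      case True
      then obtain v' where v': "v' \<in> V" "v < v'" "v' \<le> v + D"
        using step less.prems \<open>u \<in> V\<close> by blast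
      have "{y \<in> V. y > v'} \<subset> {y \<in> V. y > v}" using v' by auto
      then have lt: "card {y \<in> V. y > v'} < card {y \<in> V. y > v}"
        using \<open>finite V\<close> by (simp add: psubset_card_mono)
      then have "D * (int (card {y \<in> V. y > v'}) + 1) \<le> D * int (card {y \<in> V. y > v})"
        using D by (intro mult_left_mono) auto
      then show ?thesis using less.hyps[OF lt v'(1)] v' by (simp add: distrib_left)
    qed
  qed
  also have "\<dots> \<le> D * int (card V)"
    using D \<open>finite V\<close> by (intro mult_left_mono) (auto intro: card_mono)
  finally show ?thesis .
qed

text \<open>A discrete intermediate value argument: a sequence with steps of size at most
  \<open>D\<close> cannot jump over the values in \<open>(v, v + D]\<close>, so its range satisfies
  the step condition of \<open>Max_diff_le_card\<close>.\<close>

lemma slow_sequence_diff_le_card: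
  fixes x :: "nat \<Rightarrow> int"
  assumes fin: "finite (range x)" and slow: "\<And>i. \<bar>x (Suc i) - x i\<bar> \<le> D"
  shows "x j - x i \<le> D * int (card (range x))"
proof (rule Max_diff_le_card[OF fin])
  show "D \<ge> 0" using slow[of 0] by linarith
  fix v u assume "v \<in> range x" "u \<in> range x" "v < u"
  then obtain a b where ab: "v = x a" "u = x b" by auto
  have "\<exists>k. v < x k \<and> x k \<le> v + D"
  proof (cases "a \<le> b")
    case True
    \<comment> \<open>Walk from \<open>c\<close> back towards \<open>a\<close>, where the value is
      \<open>v\<close>. The last index still above \<open>v\<close> has a neighbour with value at
      most \<open>v\<close>, so its own value is at most \<open>v + D\<close>. The case
      \<open>b < a\<close> is the mirror image.\<close>
    have "\<exists>k. v < x k \<and> x k \<le> v + D" if "v < x c" "a \<le> c" for c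
      using that(2,1)
    proof (induction c rule: dec_induct)
      case base then show ?case using ab by simp
    next
      case (step n)
      then show ?case using slow[of n] by (cases "v < x n") (auto intro!: exI[of _ "Suc n"])
    qed
    then show ?thesis using True ab \<open>v < u\<close> by auto
  next
    case False
    have "\<exists>k. v < x k \<and> x k \<le> v + D" if "v < x c" "c \<le> a" for c
      using that(2,1)
    proof (induction c rule: inc_induct)
      case base then show ?case using ab by simp
    next
      case (step n)
      then show ?case using slow[of n] by (cases "v < x (Suc n)") (auto intro!: exI[of _ n])
    qed
    then show ?thesis using False ab \<open>v < u\<close> by auto
  qed
  then show "\<exists>v'\<in>range x. v < v' \<and> v' \<le> v + D" by auto
qed auto

text \<open>For fixed \<open>n\<close> the window sums form a slow sequence in the starting position
  with at most \<open>M\<close> values. If \<open>D\<close> bounds the letters, a shift changes the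
  sum by at most \<open>2 * D\<close>, so \<open>2 * D * int M\<close> works for all
  \<open>n\<close> at once.\<close>

lemma bounded_additive_complexity_imp_balanced:
  assumes "finite S" "w \<in> infwords S" "bounded_additive_complexity w"
  obtains C where "\<And>m m' n. m \<ge> 1 \<Longrightarrow> m' \<ge> 1 \<Longrightarrow>
    \<bar>(\<Sum>k<n. w (m + k)) - (\<Sum>k<n. w (m' + k))\<bar> \<le> (C :: int)"
proof -
  obtain D where D: "\<And>s. s \<in> S \<Longrightarrow> \<bar>s\<bar> \<le> D"
    using Max_ge[of "abs ` S"] \<open>finite S\<close> by blast
  have wD: "\<bar>w k\<bar> \<le> D" if "k \<ge> 1" for k
    using assms(2) that by (intro D) (auto simp: infwords_def)
  have D0: "D \<ge> 0" using wD[of 1] by linarith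
  obtain M where M: "\<And>n. n \<ge> 1 \<Longrightarrow> finite ((\<lambda>m. \<Sum>k<n. w (m + k)) ` {1..}) \<and>
      card ((\<lambda>m. \<Sum>k<n. w (m + k)) ` {1..}) \<le> M"
    using assms(3) unfolding bounded_additive_complexity_def
    by (auto simp: sum_list_factors_eq)
  have le: "(\<Sum>k<n. w (m + k)) - (\<Sum>k<n. w (m' + k)) \<le> 2 * D * int M"
    if "m \<ge> 1" "m' \<ge> 1" for m m' n
  proof (cases "n \<ge> 1")
    case False
    then have "n = 0" by simp
    then show ?thesis using D0 by simp
  next
    case True
    \<comment> \<open>The shift by \<open>Suc\<close> makes the sequence start at position 1, since
      the letter at position 0 is not controlled by \<open>S\<close>.\<close>
    define x where "x i = (\<Sum>k<n. w (Suc i + k))" for i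
    have rx: "range x = (\<lambda>m. \<Sum>k<n. w (m + k)) ` {1..}"
    proof -
      have "{1..} = range Suc" by (auto simp: image_iff Suc_le_D)
      then show ?thesis by (simp add: x_def image_image)
    qed
    have "\<bar>x (Suc i) - x i\<bar> \<le> 2 * D" for i
    proof -
      \<comment> \<open>The sum telescopes: only the letter entering the window and the one leaving
        it remain.\<close>
      have "x (Suc i) - x i = (\<Sum>k<n. w (Suc i + Suc k) - w (Suc i + k))"
        by (simp add: x_def sum_subtractf)
      also have "\<dots> = w (Suc i + n) - w (Suc i)"
        using sum_lessThan_telescope[of "\<lambda>k. w (Suc i + k)" n] by simp
      finally show ?thesis using wD[of "Suc i + n"] wD[of "Suc i"] by simp
    qed
    then have "x (m - 1) - x (m' - 1) \<le> 2 * D * int (card (range x))"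
      using M[OF True] by (intro slow_sequence_diff_le_card) (auto simp: rx)
    also have "\<dots> \<le> 2 * D * int M"
      using M[OF True] D0 by (intro mult_left_mono) (auto simp: rx)
    finally show ?thesis using that by (simp add: x_def)
  qed
  show ?thesis
    by (rule that[of "2 * D * int M"]) (use le in \<open>auto simp: abs_le_iff\<close>)
qed

section \<open>Comparing window sums with the slope\<close>

text \<open>A prefix of length \<open>j * n\<close> consists of \<open>j\<close> blocks of length
  \<open>n\<close>, each with sum within \<open>C\<close> of the sum \<open>W\<close> of the given
  window. Hence \<open>n\<close> times the slope of the prefix is within \<open>C\<close> of
  \<open>W\<close>, and the bound survives the limit in \<open>j\<close>.\<close>

lemma balanced_imp_bounded_discrepancy:
  assumes bal: "\<And>m m' n. m \<ge> 1 \<Longrightarrow> m' \<ge> 1 \<Longrightarrow>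
      \<bar>(\<Sum>k<n. w (m + k)) - (\<Sum>k<n. w (m' + k))\<bar> \<le> C"
    and "has_slope w \<alpha>"
  shows "bounded_discrepancy w \<alpha>"
  unfolding bounded_discrepancy_def
proof (intro exI[of _ "real_of_int C"] allI impI)
  fix m n :: nat assume m: "m \<ge> 1"
  define W where "W = (\<Sum>k<n. w (m + k))"
  have blocks: "\<bar>(\<Sum>k<j * n. w (1 + k)) - int j * W\<bar> \<le> int j * C" for j
  proof (induction j)
    case (Suc j)
    have "(\<Sum>k<Suc j * n. w (1 + k)) = (\<Sum>k<j * n. w (1 + k)) + (\<Sum>k<n. w (1 + j * n + k))"
      using sum.nat_group[of "\<lambda>k. w (1 + k)" n "Suc j"] sum.nat_group[of "\<lambda>k. w (1 + k)" n j]
        sum_window[of "\<lambda>k. w (1 + k)" "j * n" n]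
      by (simp add: add.commute add.left_commute)
    moreover have "\<bar>(\<Sum>k<n. w (1 + j * n + k)) - W\<bar> \<le> C"
      using bal[of "1 + j * n" m n] m by (simp add: W_def)
    ultimately show ?case using Suc.IH by (simp add: algebra_simps)
  qed simp
  show "\<bar>real_of_int (\<Sum>k<n. w (m + k)) - real n * \<alpha>\<bar> \<le> real_of_int C"
  proof (cases "n = 0")
    case True
    \<comment> \<open>Comparing two empty windows yields \<open>0 \<le> C\<close>.\<close>
    then show ?thesis using bal[of 1 1 0] by simp
  next
    case False
    \<comment> \<open>The limit is taken along the multiples of \<open>n\<close>;
      \<open>Suc j\<close> avoids the empty prefix.\<close>
    have "(\<lambda>j. slope (subword w 1 (Suc j * n))) \<longlonglongrightarrow> \<alpha>"
      using assms(2) unfolding has_slope_def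
      by (rule filterlim_compose)
        (intro filterlim_subseq strict_monoI; use False in simp)
    then have "(\<lambda>j. \<bar>real_of_int W - real n * slope (subword w 1 (Suc j * n))\<bar>)
        \<longlonglongrightarrow> \<bar>real_of_int W - real n * \<alpha>\<bar>"
      by (intro tendsto_intros)
    moreover have "\<bar>real_of_int W - real n * slope (subword w 1 (Suc j * n))\<bar> \<le> real_of_int C" for j
    proof -
      define T where "T = (\<Sum>k<Suc j * n. w (1 + k))"
      have "{1..Suc j * n} = {1..<1 + Suc j * n}" by auto
      then have s: "slope (subword w 1 (Suc j * n)) = real_of_int T / real (Suc j * n)"
        by (simp only: slope_def sum_list_subword length_subword sum_window T_def) simp
      have "real n * slope (subword w 1 (Suc j * n)) = real_of_int T / real (Suc j)"
        unfolding s of_nat_mult using False by simp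
      moreover have "\<bar>real_of_int T - real (Suc j) * real_of_int W\<bar> \<le> real (Suc j) * real_of_int C"
        using blocks[of "Suc j", folded T_def]
        by (metis (no_types, opaque_lifting) of_int_abs of_int_diff of_int_le_iff of_int_mult
            of_int_of_nat_eq)
      then have "\<bar>real_of_int T / real (Suc j) - real_of_int W\<bar> \<le> real_of_int C"
        by (simp add: abs_le_iff field_simps)
      ultimately show ?thesis by (simp only: abs_minus_commute)
    qed
    ultimately show ?thesis unfolding W_def by (intro LIMSEQ_le_const2) auto
  qed
qed

section \<open>Complexity and slope from bounded discrepancy\<close>

lemma bounded_discrepancy_imp_bounded_additive_complexity:
  assumes "bounded_discrepancy w \<alpha>"
  shows "bounded_additive_complexity w"
proof -
  obtain C where C: "\<And>m n. m \<ge> 1 \<Longrightarrow> \<bar>real_of_int (\<Sum>k<n. w (m + k)) - real n * \<alpha>\<bar> \<le> C"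
    using assms by (auto simp: bounded_discrepancy_def)
  \<comment> \<open>A closed real interval of length \<open>2 * C\<close>, here the one centred at
    \<open>real n * \<alpha>\<close>, contains at most this many integers.\<close>
  define M where "M = nat (\<lfloor>2 * C\<rfloor> + 1)"
  have "C \<ge> 0" using C[of 1 0] by simp
  then have "M \<ge> 1" unfolding M_def by linarith
  show ?thesis unfolding bounded_additive_complexity_def
  proof (intro exI[of _ M] conjI allI impI)
    fix n :: nat assume n: "n \<ge> 1"
    define A where "A = {\<lceil>real n * \<alpha> - C\<rceil>..\<lfloor>real n * \<alpha> + C\<rfloor>}"
    have sub: "{sum_list B | B. B \<in> factors w \<and> length B = n} \<subseteq> A"
    proof (unfold sum_list_factors_eq[OF n], rule image_subsetI)
      fix m :: nat assume "m \<in> {1..}"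
      then show "(\<Sum>k<n. w (m + k)) \<in> A"
        using C[of m n] unfolding A_def
        by (simp add: ceiling_le_iff le_floor_iff abs_le_iff del: of_int_sum)
    qed
    have "\<lfloor>real n * \<alpha> + C\<rfloor> - \<lceil>real n * \<alpha> - C\<rceil> \<le> \<lfloor>2 * C\<rfloor>"
      by (simp add: le_floor_iff) linarith
    then have "card A \<le> M" by (simp add: A_def M_def)
    moreover have "finite A" by (simp add: A_def)
    ultimately show "finite {sum_list B | B. B \<in> factors w \<and> length B = n}"
      and "card {sum_list B | B. B \<in> factors w \<and> length B = n} \<le> M"
      using sub card_mono[OF _ sub] by (auto intro: finite_subset)
  qed (fact \<open>M \<ge> 1\<close>)
qed

text \<open>The slope of a prefix of length \<open>n\<close> differs from \<alpha> by the
  discrepancy of the prefix divided by \<open>n\<close>, hence by at most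
  \<open>C / real n\<close>.\<close>

lemma bounded_discrepancy_imp_has_slope:
  assumes "bounded_discrepancy w \<alpha>"
  shows "has_slope w \<alpha>"
proof -
  obtain C where C: "\<And>m n. m \<ge> 1 \<Longrightarrow> \<bar>real_of_int (\<Sum>k<n. w (m + k)) - real n * \<alpha>\<bar> \<le> C"
    using assms by (auto simp: bounded_discrepancy_def)
  have "(\<lambda>n. slope (subword w 1 n) - \<alpha>) \<longlonglongrightarrow> 0"
  proof (rule tendsto_0_le[where K = 1])
    show "(\<lambda>n. C / real n) \<longlonglongrightarrow> 0" by (rule lim_const_over_n)
    show "\<forall>\<^sub>F n in sequentially. norm (slope (subword w 1 n) - \<alpha>) \<le> norm (C / real n) * 1"
      using eventually_gt_at_top[of 0]
    proof eventually_elim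
      case (elim n)
      have "{1..n} = {1..<1 + n}" by auto
      then have "slope (subword w 1 n) = real_of_int (\<Sum>k<n. w (1 + k)) / real n"
        by (simp only: slope_def sum_list_subword length_subword sum_window) simp
      then have "slope (subword w 1 n) - \<alpha>
          = (real_of_int (\<Sum>k<n. w (1 + k)) - real n * \<alpha>) / real n"
        using elim by (simp add: field_simps del: of_int_sum)
      then have "norm (slope (subword w 1 n) - \<alpha>)
          = \<bar>real_of_int (\<Sum>k<n. w (1 + k)) - real n * \<alpha>\<bar> / real n"
        by (simp only: real_norm_def abs_divide abs_of_nat)
      also have "\<dots> \<le> C / real n" using C[of 1 n] by (intro divide_right_mono) auto
      also have "\<dots> \<le> norm (C / real n) * 1" unfolding real_norm_def by linarith
      finally show ?case .
    qed
  qed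
  then show ?thesis unfolding has_slope_def by (simp add: LIM_zero_iff)
qed

section \<open>Deleting intervals of discrepancy zero\<close>

lemma separated_intervalsE:
  assumes "separated_intervals \<I>" "I \<in> \<I>"
  obtains m n where "1 \<le> m" "m \<le> n" "I = {m..n}"
proof -
  have "\<exists>m n. 1 \<le> m \<and> m \<le> n \<and> I = {m..n}"
    using assms by (simp add: separated_intervals_def)
  then show ?thesis using that by blast
qed

lemma separated_intervals_disjoint:
  assumes sep: "separated_intervals \<I>" and "I \<in> \<I>" "J \<in> \<I>" "I \<noteq> J"
  shows "I \<inter> J = {}"
proof -
  obtain i j where I: "i \<le> j" "I = {i..j}" using separated_intervalsE[OF sep \<open>I \<in> \<I>\<close>] by metis
  obtain k l where J: "k \<le> l" "J = {k..l}" using separated_intervalsE[OF sep \<open>J \<in> \<I>\<close>] by metis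
  have "i \<le> k \<Longrightarrow> j + 1 < k" "k \<le> i \<Longrightarrow> l + 1 < i"
    using sep assms(2-4) I J unfolding separated_intervals_def by metis+
  then show ?thesis using I J by (cases "i \<le> k") auto
qed

text \<open>As \<open>a\<close> and \<open>b\<close> are not deleted, no interval of the family is
  cut by the ends of the window. What is missing from the window is therefore a disjoint union of
  whole intervals, each contributing 0.\<close>

lemma sum_remaining_positions:
  fixes f :: "nat \<Rightarrow> real"
  assumes sep: "separated_intervals \<I>"
    and zero: "\<And>I. I \<in> \<I> \<Longrightarrow> sum f I = 0"
    and ab: "a \<in> remaining_positions \<I>" "b \<in> remaining_positions \<I>"
  shows "sum f (remaining_positions \<I> \<inter> {a..b}) = sum f {a..b}"
proof -
  define \<J> where "\<J> = {I \<in> \<I>. I \<subseteq> {a..b}}"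
  have a1: "a \<ge> 1" using ab by (simp add: remaining_positions_def)
  have "{a..b} - remaining_positions \<I> \<subseteq> \<Union>\<J>"
  proof
    fix x assume x: "x \<in> {a..b} - remaining_positions \<I>"
    then obtain I where I: "I \<in> \<I>" "x \<in> I" using a1 by (auto simp: remaining_positions_def)
    obtain i j where ij: "I = {i..j}" using separated_intervalsE[OF sep I(1)] by metis
    have "a \<notin> I" "b \<notin> I" using ab I by (auto simp: remaining_positions_def)
    then have "I \<subseteq> {a..b}" using x I ij by auto
    then show "x \<in> \<Union>\<J>" using I by (auto simp: \<J>_def)
  qed
  then have "{a..b} - remaining_positions \<I> = \<Union>\<J>"
    by (auto simp: \<J>_def remaining_positions_def)
  moreover have "sum f (\<Union>\<J>) = (\<Sum>I\<in>\<J>. sum f I)"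
    using separated_intervals_disjoint[OF sep]
    by (subst sum.Union_disjoint) (auto simp: \<J>_def intro: finite_subset)
  moreover have "(\<Sum>I\<in>\<J>. sum f I) = 0" using zero by (simp add: \<J>_def)
  moreover have "sum f {a..b} = sum f ({a..b} \<inter> remaining_positions \<I>)
      + sum f ({a..b} - remaining_positions \<I>)"
    by (rule sum.Int_Diff) simp
  ultimately show ?thesis by (simp add: Int_commute)
qed

text \<open>\<open>enumerate R\<close> is strictly increasing and onto \<open>R\<close>. So
  consecutive letters of the contracted word come from all remaining positions between the first and
  the last of them.\<close>

lemma enumerate_image_atLeastAtMost:
  fixes R :: "nat set"
  assumes "infinite R"
  shows "enumerate R ` {i..j} = R \<inter> {enumerate R i..enumerate R j}"
proof (intro equalityI subsetI)
  fix x assume "x \<in> R \<inter> {enumerate R i..enumerate R j}"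
  then obtain k where "x = enumerate R k" "enumerate R i \<le> enumerate R k"
      "enumerate R k \<le> enumerate R j"
    using enumerate_Ex[OF assms] by (metis IntD1 IntD2 atLeastAtMost_iff)
  then show "x \<in> enumerate R ` {i..j}"
    using assms by auto
qed (use assms in \<open>auto simp: enumerate_in_set\<close>)

lemma bounded_discrepancy_contraction:
  assumes "bounded_discrepancy w \<alpha>" and sep: "separated_intervals \<I>"
    and slopes: "\<And>m n. 1 \<le> m \<Longrightarrow> m \<le> n \<Longrightarrow> {m..n} \<in> \<I> \<Longrightarrow> slope (subword w m n) = \<alpha>"
  shows "bounded_discrepancy (contraction w \<I>) \<alpha>"
proof -
  obtain C where C: "\<And>m n. m \<ge> 1 \<Longrightarrow> \<bar>real_of_int (\<Sum>k<n. w (m + k)) - real n * \<alpha>\<bar> \<le> C"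
    using assms(1) by (auto simp: bounded_discrepancy_def)
  define R where "R = remaining_positions \<I>"
  have inf: "infinite R" unfolding R_def by (rule infinite_remaining_positions[OF sep])
  \<comment> \<open>With \<open>f\<close>, the discrepancy of a window becomes a plain sum, and a
    nonempty interval has slope \<alpha> exactly when \<open>f\<close> sums to 0 over it.\<close>
  define f where "f k = real_of_int (w k) - \<alpha>" for k
  have zero: "sum f I = 0" if "I \<in> \<I>" for I
  proof -
    obtain m n where mn: "1 \<le> m" "m \<le> n" "I = {m..n}"
      using separated_intervalsE[OF sep \<open>I \<in> \<I>\<close>] by metis
    then have "slope (subword w m n) = \<alpha>" using slopes that by blast
    then have "real_of_int (\<Sum>k\<in>{m..n}. w k) = \<alpha> * real (Suc n - m)"
      using mn by (simp add: slope_def sum_list_subword length_subword field_simps del: of_int_sum)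
    then show ?thesis by (simp add: f_def mn sum_subtractf)
  qed
  have "\<bar>real_of_int (\<Sum>k<n. contraction w \<I> (m + k)) - real n * \<alpha>\<bar> \<le> C" if m: "m \<ge> 1" for m n
  proof (cases "n = 0")
    case True
    then show ?thesis using C[of 1 0] by simp
  next
    case False
    \<comment> \<open>The positions in \<open>w\<close> of the first and last letter of the window.
      One 1 is subtracted because \<open>enumerate\<close> counts from 0, the other because the last
      index is inclusive; the latter is safe as \<open>n \<noteq> 0\<close>.\<close>
    define a b where "a = enumerate R (m - 1)" and "b = enumerate R (m - 1 + n - 1)"
    have abR: "a \<in> R" "b \<in> R" by (simp_all add: a_def b_def enumerate_in_set inf)
    have "a \<ge> 1" using abR by (simp add: R_def remaining_positions_def)
    have "a \<le> b" using inf False by (simp add: a_def b_def)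
    have "real_of_int (\<Sum>k<n. contraction w \<I> (m + k)) - real n * \<alpha>
        = (\<Sum>k<n. f (enumerate R (m - 1 + k)))"
      using m by (simp add: contraction_def R_def f_def sum_subtractf)
    also have "\<dots> = (\<Sum>k\<in>{m - 1..<m - 1 + n}. f (enumerate R k))"
      by (rule sum_window[symmetric])
    also have "{m - 1..<m - 1 + n} = {m - 1..m - 1 + n - 1}" using False by auto
    also have "(\<Sum>k\<in>{m - 1..m - 1 + n - 1}. f (enumerate R k))
        = sum f (enumerate R ` {m - 1..m - 1 + n - 1})"
      using inj_enumerate[OF inf] by (subst sum.reindex) (auto intro: inj_on_subset)
    also have "\<dots> = sum f (R \<inter> {a..b})"
      by (simp only: enumerate_image_atLeastAtMost[OF inf] a_def b_def)
    \<comment> \<open>Putting the deleted letters back does not change the discrepancy, so the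
      contracted word inherits the constant \<open>C\<close> itself.\<close>
    also have "\<dots> = sum f {a..b}"
      using sum_remaining_positions[OF sep zero] abR by (simp add: R_def)
    also have "{a..b} = {a..<a + (Suc b - a)}" using \<open>a \<le> b\<close> by auto
    also have "sum f \<dots> = real_of_int (\<Sum>k<Suc b - a. w (a + k)) - real (Suc b - a) * \<alpha>"
      by (simp only: sum_window f_def sum_subtractf) simp
    finally show ?thesis using C[OF \<open>a \<ge> 1\<close>, of "Suc b - a"] by (simp only:)
  qed
  then show ?thesis unfolding bounded_discrepancy_def by blast
qed

theorem theorem2p7:
  fixes S :: "int set" and \<omega> :: infword and p q :: int and \<I> :: "nat set set"
  assumes "finite S"
    and "\<omega> \<in> infwords S"
    and "bounded_additive_complexity \<omega>"
    and "q \<noteq> 0"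
    and "has_slope \<omega> (real_of_int p / real_of_int q)"
    and "separated_intervals \<I>"
    and "\<And>m n. 1 \<le> m \<Longrightarrow> m \<le> n \<Longrightarrow> {m..n} \<in> \<I> \<Longrightarrow>
               slope (subword \<omega> m n) = real_of_int p / real_of_int q"
  shows "bounded_additive_complexity (contraction \<omega> \<I>) \<and>
         has_slope (contraction \<omega> \<I>) (real_of_int p / real_of_int q)"
proof -
  have "bounded_discrepancy \<omega> (real_of_int p / real_of_int q)"
    using bounded_additive_complexity_imp_balanced[OF assms(1-3)]
      balanced_imp_bounded_discrepancy[OF _ assms(5)] by metis
  then have "bounded_discrepancy (contraction \<omega> \<I>) (real_of_int p / real_of_int q)"
    using assms(6,7) by (rule bounded_discrepancy_contraction)
  then show ?thesis
    using bounded_discrepancy_imp_bounded_additive_complexity bounded_discrepancy_imp_has_slope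
    by blast
qed

end
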